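(* Let $S = R \cup B$ be a set of $2n$ points in general position (no three collinear) in the plane, where $R$ is the set of red points, $B$ the set of blue points, and $|R| = |B| = n$. Then $S$ has at least $\frac{n^2-4n}{12}$ balanced $4$-holes.
   Context: A hole of $S$ is a simple polygon $Q$ whose vertices are points of $S$ and whose interior contains no point of $S$; a $k$-hole is a hole with $k$ vertices. Holes need not be convex. A $4$-hole is balanced if it has exactly two red and two blue vertices. *)

theory Defs
  imports "HOL-Analysis.Analysis"
begin

definition general_position :: "complex set \<Rightarrow> bool" where
  "general_position S \<longleftrightarrow>
     (\<forall>a\<in>S. \<forall>b\<in>S. \<forall>c\<in>S. distinct [a,b,c] \<longrightarrow> \<not> collinear {a,b,c})"

definition quad_boundary :: "complex \<Rightarrow> complex \<Rightarrow> complex \<Rightarrow> complex \<Rightarrow> complex set" where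
  "quad_boundary a b c d =
     closed_segment a b \<union> closed_segment b c \<union> closed_segment c d \<union> closed_segment d a"

definition simple_quad :: "complex \<Rightarrow> complex \<Rightarrow> complex \<Rightarrow> complex \<Rightarrow> bool" where
  "simple_quad a b c d \<longleftrightarrow> distinct [a,b,c,d]
     \<and> closed_segment a b \<inter> closed_segment c d = {}
     \<and> closed_segment b c \<inter> closed_segment d a = {}
     \<and> closed_segment a b \<inter> closed_segment b c = {b}
     \<and> closed_segment b c \<inter> closed_segment c d = {c}
     \<and> closed_segment c d \<inter> closed_segment d a = {d}
     \<and> closed_segment d a \<inter> closed_segment a b = {a}"

definition is_4hole :: "complex set \<Rightarrow> complex \<Rightarrow> complex \<Rightarrow> complex \<Rightarrow> complex \<Rightarrow> bool" where
  "is_4hole S a b c d \<longleftrightarrow> {a,b,c,d} \<subseteq> S \<and> simple_quad a b c d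
     \<and> S \<inter> inside (quad_boundary a b c d) = {}"

text \<open>A polygon is identified with its set of edges (independent of starting vertex
  and orientation).\<close>
definition quad_edges :: "complex \<Rightarrow> complex \<Rightarrow> complex \<Rightarrow> complex \<Rightarrow> complex set set" where
  "quad_edges a b c d = {{a,b},{b,c},{c,d},{d,a}}"

definition balanced_4holes :: "complex set \<Rightarrow> complex set \<Rightarrow> complex set set set" where
  "balanced_4holes R B =
     {quad_edges a b c d | a b c d. is_4hole (R \<union> B) a b c d
        \<and> card ({a,b,c,d} \<inter> R) = 2 \<and> card ({a,b,c,d} \<inter> B) = 2}"

end

theory Submission
  imports Defs
begin

text \<open>
  Call a red-blue pair good if both its points are vertices of a common balanced 4-hole. A balanced
  4-hole accounts for at most four good pairs, so it suffices to find \<open>(n\<^sup>2 - 4n)/3\<close> of them.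

  Two empty triangles \<open>a b p\<close>, \<open>a b q\<close> on opposite sides of \<open>a b\<close> form a 4-hole \<open>a p b q\<close>. If both a
  red and a blue point form an empty triangle with the pair \<open>r\<close>, \<open>b\<close>, then the pair is good: either the
  triangles lie on opposite sides of \<open>r b\<close>, or, among the points on one side spanning empty triangles
  with \<open>r b\<close>, two angularly consecutive ones of different color give a convex 4-hole. So for a bad pair
  all empty triangles on \<open>r b\<close> have, say, a red third vertex. Let \<open>b'\<close> be the next blue point after
  \<open>b\<close> around \<open>r\<close>. The wedge between them contains red points only; it is not empty, as \<open>r b b'\<close> would
  then be an empty triangle, and one or two red points in it yield a balanced 4-hole with vertices
  \<open>r\<close>, \<open>b\<close>, \<open>b'\<close>. Hence it contains at least three. As the wedges at \<open>r\<close> are disjoint and at most one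
  \<open>b\<close> has no successor \<open>b'\<close> at an angle below \<open>\<pi>\<close>, at most \<open>(n + 2)/3\<close> such \<open>b\<close> exist for each \<open>r\<close>.
  By symmetry at most \<open>2n(n + 2)/3\<close> pairs are bad.
\<close>

section \<open>Orientation and triangles\<close>

text \<open>Twice the signed area of the triangle, positive iff it runs counterclockwise. All
  geometry below is reduced to signs of this polynomial.\<close>

definition orient :: "complex \<Rightarrow> complex \<Rightarrow> complex \<Rightarrow> real" where
  "orient a b c = (Re b - Re a) * (Im c - Im a) - (Im b - Im a) * (Re c - Re a)"

lemma orient_rotate: "orient b c a = orient a b c"
  by (simp add: orient_def algebra_simps)

lemma orient_rotate': "orient c a b = orient a b c"
  by (simp add: orient_def algebra_simps)

lemma orient_swap: "orient b a c = - orient a b c"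
  by (simp add: orient_def algebra_simps)

lemma orient_swap': "orient a c b = - orient a b c"
  by (simp add: orient_def algebra_simps)

lemma orient_degenerate [simp]: "orient a a b = 0" "orient a b a = 0" "orient b a a = 0"
  by (simp_all add: orient_def algebra_simps)

text \<open>\<open>orient u v\<close> is affine, and \<open>orient b c z\<close>,
  \<open>orient c a z\<close>, \<open>orient a b z\<close> are the barycentric weights of
  \<open>z\<close> scaled by \<open>orient a b c\<close>. Without division, the identity holds for
  degenerate triangles too.\<close>

lemma orient_barycentric:
  "orient a b c * orient u v z =
     orient b c z * orient u v a + orient c a z * orient u v b + orient a b z * orient u v c"
  by (simp add: orient_def algebra_simps)

lemma orient_split: "orient a b c = orient a b z + orient b c z + orient c a z"
  by (simp add: orient_def algebra_simps)

lemma orient_convex_combination: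
  "orient a b ((1 - t) *\<^sub>R x + t *\<^sub>R y) = (1 - t) * orient a b x + t * orient a b y"
  by (simp add: orient_def algebra_simps)

lemma orient_0_imp_collinear:
  assumes "orient a b c = 0"
  shows "collinear {a, b, c}"
proof (cases "a = b")
  case True
  then show ?thesis by simp
next
  case False
  define d where "d = (Re b - Re a)\<^sup>2 + (Im b - Im a)\<^sup>2"
  \<comment> \<open>Coefficient of the orthogonal projection of \<open>c - a\<close> onto
    \<open>b - a\<close>; the vanishing cross product \<open>o\<close> makes the projection
    exact.\<close>
  define k where "k = ((Re b - Re a) * (Re c - Re a) + (Im b - Im a) * (Im c - Im a)) / d"
  have d: "d \<noteq> 0"
    using False by (auto simp: d_def complex_eq_iff sum_power2_eq_zero_iff)
  have o: "(Re b - Re a) * (Im c - Im a) = (Im b - Im a) * (Re c - Re a)"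
    using assms by (simp add: orient_def)
  have "k * (Re b - Re a) = Re c - Re a"
    using d o unfolding k_def
    by (simp add: divide_eq_eq) (unfold d_def, algebra)
  moreover have "k * (Im b - Im a) = Im c - Im a"
    using d o unfolding k_def
    by (simp add: divide_eq_eq) (unfold d_def, algebra)
  ultimately have "c - a = k *\<^sub>R (b - a)"
    by (simp add: complex_eq_iff)
  then have "c = a + k *\<^sub>R (b - a)" by (simp add: algebra_simps)
  then have "c = (1 - k) *\<^sub>R a + (1 - (1 - k)) *\<^sub>R b" by (simp add: algebra_simps)
  then have "collinear {a, c, b}" unfolding collinear_3_expand by blast
  then show ?thesis by (simp add: insert_commute)
qed

lemma general_position_orient:
  assumes "general_position S" "a \<in> S" "b \<in> S" "c \<in> S" "a \<noteq> b" "b \<noteq> c" "a \<noteq> c"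
  shows "orient a b c \<noteq> 0"
  using assms orient_0_imp_collinear[of a b c] unfolding general_position_def by auto

text \<open>Strict interior, with both sign patterns so that the order of the vertices is
  irrelevant. In a degenerate triangle the three values sum to zero, so it has no inner points and
  counts as empty.\<close>

definition in_triangle :: "complex \<Rightarrow> complex \<Rightarrow> complex \<Rightarrow> complex \<Rightarrow> bool" where
  "in_triangle a b c z \<longleftrightarrow>
     orient a b z > 0 \<and> orient b c z > 0 \<and> orient c a z > 0 \<or>
     orient a b z < 0 \<and> orient b c z < 0 \<and> orient c a z < 0"

definition empty_triangle :: "complex set \<Rightarrow> complex \<Rightarrow> complex \<Rightarrow> complex \<Rightarrow> bool" where
  "empty_triangle S a b c \<longleftrightarrow> (\<forall>z\<in>S. \<not> in_triangle a b c z)"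

lemma in_triangle_rotate: "in_triangle b c a z = in_triangle a b c z"
  by (auto simp: in_triangle_def)

lemma in_triangle_swap: "in_triangle b a c z = in_triangle a b c z"
  unfolding in_triangle_def orient_swap[of b a] orient_swap[of a c] orient_swap[of c b] by auto

lemma empty_triangle_rotate: "empty_triangle S b c a = empty_triangle S a b c"
  by (simp add: empty_triangle_def in_triangle_rotate)

lemma empty_triangle_swap: "empty_triangle S b a c = empty_triangle S a b c"
  by (simp add: empty_triangle_def in_triangle_swap)

lemma in_triangle_ccw:
  assumes "orient a b c > 0"
  shows "in_triangle a b c z \<longleftrightarrow> orient a b z > 0 \<and> orient b c z > 0 \<and> orient c a z > 0"
  using orient_split[of a b c z] assms by (auto simp: in_triangle_def)

text \<open>The barycentric weights of \<open>z\<close> are nonnegative. Unless \<open>z\<close> is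
  a vertex, general position keeps it off the three side lines, so all weights are positive and
  \<open>z\<close> is an inner point.\<close>

lemma hull_Int_empty_triangle:
  assumes gp: "general_position S" and abc: "a \<in> S" "b \<in> S" "c \<in> S" "orient a b c \<noteq> 0"
    and emp: "empty_triangle S a b c"
  shows "S \<inter> convex hull {a, b, c} \<subseteq> {a, b, c}"
proof
  fix z assume z: "z \<in> S \<inter> convex hull {a, b, c}"
  then obtain u v w where uvw: "0 \<le> u" "0 \<le> v" "0 \<le> w" "u + v + w = 1"
      and z_eq: "z = u *\<^sub>R a + v *\<^sub>R b + w *\<^sub>R c"
    unfolding convex_hull_3 by auto
  have u: "u = 1 - v - w" using uvw by simp
  have o: "orient a b z = w * orient a b c" "orient b c z = u * orient a b c"
    "orient c a z = v * orient a b c"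
    unfolding z_eq u by (simp_all add: orient_def algebra_simps)
  show "z \<in> {a, b, c}"
  proof (rule ccontr)
    assume nz: "z \<notin> {a, b, c}"
    have "a \<noteq> b" "b \<noteq> c" "c \<noteq> a" using abc(4) by auto
    then have "orient a b z \<noteq> 0" "orient b c z \<noteq> 0" "orient c a z \<noteq> 0"
      using nz z abc gp general_position_orient[of S] by auto
    then have "u > 0" "v > 0" "w > 0" using o uvw by (auto simp: less_le)
    then have "in_triangle a b c z"
      unfolding in_triangle_def o using abc(4)
      by (auto simp: zero_less_mult_iff mult_less_0_iff)
    then show False using emp z by (auto simp: empty_triangle_def)
  qed
qed

section \<open>A 4-hole from two empty triangles\<close>

lemma closed_segments_meet_at_vertex:
  assumes "orient u v w \<noteq> 0"
  shows "closed_segment u v \<inter> closed_segment v w = {v}"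
proof -
  have "x = v" if x: "x \<in> closed_segment u v" "x \<in> closed_segment v w" for x
  proof -
    obtain s where s: "x = (1 - s) *\<^sub>R u + s *\<^sub>R v" using x(1) by (auto simp: in_segment)
    obtain t where t: "x = (1 - t) *\<^sub>R v + t *\<^sub>R w" using x(2) by (auto simp: in_segment)
    have "orient u v x = 0" unfolding s orient_convex_combination by simp
    moreover have "orient u v x = t * orient u v w" unfolding t orient_convex_combination by simp
    ultimately have "t = 0" using assms by simp
    then show ?thesis using t by simp
  qed
  then show ?thesis by auto
qed

text \<open>The two segments leave the line \<open>a b\<close> on opposite sides, so a common point
  would lie on that line and equal both \<open>a\<close> and \<open>b\<close>.\<close>

lemma closed_segments_separated:
  assumes "orient a b p * orient a b q < 0"
  shows "closed_segment a p \<inter> closed_segment b q = {}"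
proof -
  have False if x: "x \<in> closed_segment a p" "x \<in> closed_segment b q" for x
  proof -
    obtain s where s: "x = (1 - s) *\<^sub>R a + s *\<^sub>R p" "0 \<le> s" using x(1) by (auto simp: in_segment)
    obtain t where t: "x = (1 - t) *\<^sub>R b + t *\<^sub>R q" "0 \<le> t" using x(2) by (auto simp: in_segment)
    have "orient a b x = s * orient a b p" unfolding s orient_convex_combination by simp
    moreover have "orient a b x = t * orient a b q" unfolding t orient_convex_combination by simp
    ultimately have "s * orient a b p = t * orient a b q" by simp
    then have "s * (orient a b p)\<^sup>2 = t * (orient a b p * orient a b q)"
      by (simp add: power2_eq_square)
    moreover have "t * (orient a b p * orient a b q) \<le> 0"
      using assms t mult_nonneg_nonpos[of t "orient a b p * orient a b q"] by auto
    ultimately have "s * (orient a b p)\<^sup>2 \<le> 0" by simp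
    moreover have "orient a b p \<noteq> 0" "orient a b q \<noteq> 0" "a \<noteq> b" using assms by auto
    ultimately have "s = 0" using s by (simp add: mult_le_0_iff)
    then have "t = 0" using \<open>s * orient a b p = _\<close> \<open>orient a b q \<noteq> 0\<close> by simp
    then show False using s t \<open>s = 0\<close> \<open>a \<noteq> b\<close> by simp
  qed
  then show ?thesis by auto
qed

text \<open>From a point outside the star-shaped set \<open>T\<close>, the ray pointing away from
  the center \<open>m\<close> never enters \<open>T\<close>. It therefore avoids \<open>P\<close>,
  so the point has an unbounded component.\<close>

lemma inside_subset_starlike:
  fixes T :: "complex set"
  assumes star: "\<And>x. x \<in> T \<Longrightarrow> closed_segment m x \<subseteq> T" and m: "m \<in> T" and "P \<subseteq> T"
  shows "inside P \<subseteq> T"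
proof
  fix z assume z: "z \<in> inside P"
  show "z \<in> T"
  proof (rule ccontr)
    assume nz: "z \<notin> T"
    define L where "L = (\<lambda>t. z + t *\<^sub>R (z - m)) ` {0..}"
    have mz: "z \<noteq> m" using m nz by auto
    have "L \<inter> T = {}"
    proof -
      have False if t: "t \<ge> 0" "z + t *\<^sub>R (z - m) \<in> T" for t :: real
      proof -
        have "z = (1 - 1/(1+t)) *\<^sub>R m + (1/(1+t)) *\<^sub>R (z + t *\<^sub>R (z - m))"
        proof -
          have "z + t *\<^sub>R (z - m) = (1+t) *\<^sub>R z - t *\<^sub>R m" by (simp add: algebra_simps)
          then have "(1/(1+t)) *\<^sub>R (z + t *\<^sub>R (z - m)) = z - (t/(1+t)) *\<^sub>R m"
            using t unfolding \<open>z + t *\<^sub>R (z - m) = _\<close> by (simp add: scaleR_diff_right)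
          moreover have "1 - 1/(1+t) = t/(1+t)" using t by (simp add: field_simps)
          ultimately show ?thesis by simp
        qed
        then have "z \<in> closed_segment m (z + t *\<^sub>R (z - m))"
          unfolding in_segment using t by (intro exI[of _ "1/(1+t)"]) auto
        then show False using star[OF t(2)] nz by auto
      qed
      then show ?thesis by (auto simp: L_def)
    qed
    then have "L \<subseteq> - P" using assms by auto
    moreover have "connected L" unfolding L_def
      by (intro connected_continuous_image continuous_intros) auto
    moreover have zL: "z \<in> L" unfolding L_def by (auto intro!: image_eqI[of _ _ 0])
    ultimately have "L \<subseteq> connected_component_set (- P) z"
      by (intro connected_component_maximal)
    moreover have "bounded (connected_component_set (- P) z)"
      using z by (auto simp: inside_def)
    ultimately have "bounded L" using bounded_subset by blast
    then obtain K where K: "\<And>x. x \<in> L \<Longrightarrow> norm x \<le> K" by (auto simp: bounded_iff)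
    define t where "t = (\<bar>K\<bar> + norm z + 1) / norm (z - m)"
    have t: "t \<ge> 0" by (simp add: t_def)
    have "norm (t *\<^sub>R (z - m)) = \<bar>K\<bar> + norm z + 1"
      using mz by (simp add: t_def)
    moreover have "norm (t *\<^sub>R (z - m)) - norm z \<le> norm (z + t *\<^sub>R (z - m))"
      by (metis add.commute norm_diff_ineq)
    moreover have "norm (z + t *\<^sub>R (z - m)) \<le> K" using t by (intro K) (auto simp: L_def)
    ultimately show False by linarith
  qed
qed

text \<open>The union of the two closed triangles is star-shaped about \<open>a\<close> and contains
  the boundary, hence also the inside. Its only points of \<open>S\<close> are the four vertices,
  which lie on the boundary. The quadrilateral need not be convex.\<close>

lemma quad_hole:
  assumes gp: "general_position S" and S: "a \<in> S" "b \<in> S" "p \<in> S" "q \<in> S"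
    and pq: "orient a b p * orient a b q < 0"
    and ep: "empty_triangle S a b p" and eq: "empty_triangle S a b q"
  shows "is_4hole S a p b q"
proof -
  let ?T = "convex hull {a, b, p} \<union> convex hull {a, b, q}"
  have nz: "orient a b p \<noteq> 0" "orient a b q \<noteq> 0" using pq by auto
  have dist: "a \<noteq> b" "p \<noteq> q" "a \<noteq> p" "b \<noteq> p" "a \<noteq> q" "b \<noteq> q"
    using pq not_square_less_zero[of "orient a b p"] by auto
  have "orient a p b \<noteq> 0" "orient b q a \<noteq> 0" "orient p b q \<noteq> 0" "orient q a p \<noteq> 0"
    using gp S dist general_position_orient[of S] by auto
  note this [THEN closed_segments_meet_at_vertex]
  moreover have "closed_segment a p \<inter> closed_segment b q = {}"
      "closed_segment a q \<inter> closed_segment b p = {}"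
    using pq by (auto intro!: closed_segments_separated simp: mult.commute)
  ultimately have "simple_quad a p b q"
    unfolding simple_quad_def using dist by (auto simp: closed_segment_commute)
  moreover have "S \<inter> inside (quad_boundary a p b q) = {}"
  proof -
    have hull: "a \<in> convex hull {a,b,p}" "b \<in> convex hull {a,b,p}" "p \<in> convex hull {a,b,p}"
      "a \<in> convex hull {a,b,q}" "b \<in> convex hull {a,b,q}" "q \<in> convex hull {a,b,q}"
      by (auto intro: hull_inc)
    have "closed_segment a x \<subseteq> ?T" if "x \<in> ?T" for x
      using that hull by (meson UnE closed_segment_subset convex_convex_hull le_supI1 le_supI2)
    moreover have "quad_boundary a p b q \<subseteq> ?T"
      unfolding quad_boundary_def using hull
      by (intro Un_least) (meson closed_segment_subset convex_convex_hull le_supI1 le_supI2)+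
    ultimately have "inside (quad_boundary a p b q) \<subseteq> ?T"
      using hull by (intro inside_subset_starlike[where m = a]) auto
    moreover have "S \<inter> ?T \<subseteq> {a, b, p, q}"
      using hull_Int_empty_triangle[OF gp _ _ _ nz(1) ep] hull_Int_empty_triangle[OF gp _ _ _ nz(2) eq] S
      by auto
    moreover have "{a, b, p, q} \<subseteq> quad_boundary a p b q"
      by (auto simp: quad_boundary_def)
    ultimately show ?thesis
      using inside_no_overlap[of "quad_boundary a p b q"] by blast
  qed
  ultimately show ?thesis using S by (auto simp: is_4hole_def)
qed


section \<open>Good pairs from empty triangles of both colors\<close>

text \<open>All barycentric weights of \<open>z\<close> are positive and \<open>orient u v\<close>
  is affine. This is the tool for inclusions between triangles and wedges.\<close>

lemma orient_pos_in_triangle: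
  assumes "orient a b c > 0" "orient a b z > 0" "orient b c z > 0" "orient c a z > 0"
    and "orient u v a \<ge> 0" "orient u v b \<ge> 0" "orient u v c \<ge> 0"
    and "orient u v a > 0 \<or> orient u v b > 0 \<or> orient u v c > 0"
  shows "orient u v z > 0"
proof -
  have "0 \<le> orient b c z * orient u v a" "0 \<le> orient c a z * orient u v b"
    "0 \<le> orient a b z * orient u v c"
    using assms by auto
  moreover have "0 < orient b c z * orient u v a \<or> 0 < orient c a z * orient u v b
      \<or> 0 < orient a b z * orient u v c"
    using assms by auto
  ultimately have "orient a b c * orient u v z > 0"
    using orient_barycentric[of a b c u v z] by linarith
  then show ?thesis using assms(1) by (simp add: zero_less_mult_iff)
qed

text \<open>\<open>Q\<close> is a set of edges, so \<open>\<Union>Q\<close> is its vertex set; the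
  pair may be a side or a diagonal.\<close>

definition good :: "complex set \<Rightarrow> complex set \<Rightarrow> complex \<Rightarrow> complex \<Rightarrow> bool" where
  "good R B r b \<longleftrightarrow> (\<exists>Q\<in>balanced_4holes R B. r \<in> \<Union>Q \<and> b \<in> \<Union>Q)"

lemma balanced_4holes_commute: "balanced_4holes R B = balanced_4holes B R"
  unfolding balanced_4holes_def by (simp add: Un_commute conj_commute)

lemma good_commute: "good R B r b = good B R b r"
  unfolding good_def using balanced_4holes_commute[of R B] by auto

lemma Union_quad_edges: "\<Union> (quad_edges a b c d) = {a, b, c, d}"
  by (auto simp: quad_edges_def)

text \<open>The hole is \<open>a p b q\<close> with diagonal \<open>a b\<close>;
  \<open>verts\<close> leaves open where on it the colors sit.\<close>

lemma goodI:
  assumes gp: "general_position (R \<union> B)" and disj: "R \<inter> B = {}"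
    and R: "x \<in> R" "y \<in> R" "x \<noteq> y" and B: "c \<in> B" "d \<in> B" "c \<noteq> d"
    and verts: "{a, p, b, q} = {x, y, c, d}"
    and "orient a b p * orient a b q < 0"
    and "empty_triangle (R \<union> B) a b p" "empty_triangle (R \<union> B) a b q"
  shows "good R B x c"
proof -
  have "{a, p, b, q} \<subseteq> R \<union> B" unfolding verts using R B by auto
  then have "is_4hole (R \<union> B) a p b q" using assms by (intro quad_hole) auto
  moreover have "{a, p, b, q} \<inter> R = {x, y}" "{a, p, b, q} \<inter> B = {c, d}"
    unfolding verts using R B disj by auto
  ultimately have "quad_edges a p b q \<in> balanced_4holes R B"
    unfolding balanced_4holes_def using R B by force
  moreover have "x \<in> \<Union> (quad_edges a p b q)" "c \<in> \<Union> (quad_edges a p b q)"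
    unfolding Union_quad_edges verts by auto
  ultimately show ?thesis unfolding good_def by blast
qed

text \<open>Induction on the number of points inside \<open>a x y\<close>: the one nearest to the
  line \<open>a b\<close> replaces \<open>x\<close> or \<open>y\<close>, keeping the colors
  different. In the final configuration the line \<open>a x\<close> separates \<open>b\<close> from
  \<open>y\<close>, so \<open>a x\<close> is the diagonal of a hole.\<close>

lemma color_change_empty:
  fixes C :: "complex \<Rightarrow> bool"
  assumes fin: "finite S" and gp: "general_position S" and ab: "a \<in> S" "b \<in> S"
    and "x \<in> S" "y \<in> S" "orient a b x > 0" "orient a b y > 0"
    and "empty_triangle S a b x" "empty_triangle S a b y" "orient a x y > 0" "C x \<noteq> C y"
  shows "\<exists>x\<in>S. \<exists>y\<in>S. orient a b x > 0 \<and> empty_triangle S a b x \<and> orient a b y > 0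
     \<and> orient a x y > 0 \<and> C x \<noteq> C y \<and> empty_triangle S a x y"
  using assms(5-)
proof (induction "card {z \<in> S. in_triangle a x y z}" arbitrary: x y rule: less_induct)
  case less
  note abx = less.prems(3) and aby = less.prems(4) and axy = less.prems(7)
  let ?I = "\<lambda>x y. {z \<in> S. in_triangle a x y z}"
  show ?case
  proof (cases "empty_triangle S a x y")
    case True
    then show ?thesis using less.prems by blast
  next
    case False
    then have ne: "?I x y \<noteq> {}" by (auto simp: empty_triangle_def)
    have finI: "finite (?I x y)" using fin by simp
    obtain q where q: "q \<in> ?I x y" and qmin: "\<And>z. z \<in> ?I x y \<Longrightarrow> orient a b q \<le> orient a b z"
      using ex_is_arg_min_if_finite[OF finI ne, of "orient a b"] by (auto simp: is_arg_min_linorder)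
    have qS: "q \<in> S" and axq: "orient a x q > 0" and xyq: "orient x y q > 0" and yaq: "orient y a q > 0"
      using q in_triangle_ccw[OF axy] by auto
    have xb: "x \<noteq> b" "y \<noteq> b" "x \<noteq> y" using abx aby axy by auto
    \<comment> \<open>\<open>x\<close> lies in the angle at \<open>a\<close> between
      \<open>b\<close> and \<open>y\<close>, so emptiness of \<open>a b y\<close> forces it beyond
      the line \<open>b y\<close>.\<close>
    have bxy: "orient b x y > 0"
    proof -
      have "\<not> in_triangle a b y x" using less.prems by (auto simp: empty_triangle_def)
      then have "\<not> orient b y x > 0"
        using abx axy unfolding in_triangle_ccw[OF aby] by (simp add: orient_rotate orient_rotate')
      moreover have "orient b y x \<noteq> 0"
        using xb less.prems ab gp general_position_orient[of S b y x] by auto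
      ultimately show ?thesis using orient_swap'[of b y x] by linarith
    qed
    have abq: "orient a b q > 0"
      using orient_pos_in_triangle[OF axy axq xyq yaq, of a b] abx aby by simp
    have bxq: "orient b x q > 0"
      using orient_pos_in_triangle[OF axy axq xyq yaq, of b x] abx bxy orient_rotate[of b x a] by simp
    \<comment> \<open>As \<open>q\<close> is closest to the line \<open>a b\<close>, it can replace the vertex of its own color.\<close>
    have eq: "empty_triangle S a b q"
      unfolding empty_triangle_def
    proof (intro ballI notI)
      fix z assume z: "z \<in> S" "in_triangle a b q z"
      then have abz: "orient a b z > 0" and bqz: "orient b q z > 0" and qaz: "orient q a z > 0"
        using in_triangle_ccw[OF abq] by auto
      note pos = orient_pos_in_triangle[OF abq abz bqz qaz]
      have bxz: "orient b x z > 0"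
        using pos[of b x] abx bxq orient_rotate[of b x a] by simp
      have yaz: "orient y a z > 0"
        using pos[of y a] yaq aby orient_rotate'[of y a b] by simp
      have xyz: "orient x y z > 0"
        using pos[of x y] axy bxy xyq orient_rotate[of x y a] orient_rotate[of x y b] by simp
      \<comment> \<open>Either \<open>z\<close> is in the triangle \<open>a x y\<close> and closer
        to \<open>a b\<close> than \<open>q\<close>, or it is in the empty triangle
        \<open>a b x\<close>, or it violates general position.\<close>
      consider "orient a x z > 0" | "orient a x z < 0" | "orient a x z = 0" by linarith
      then show False
      proof cases
        case 1
        then have "z \<in> ?I x y" using z xyz yaz in_triangle_ccw[OF axy] by simp
        then have "orient a b q \<le> orient a b z" by (rule qmin)
        then show False using orient_split[of a b q z] bqz qaz by linarith
      next
        case 2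
        then have "in_triangle a b x z"
          using abz bxz in_triangle_ccw[OF abx] orient_swap[of a x z] by simp
        then show False using less.prems z by (auto simp: empty_triangle_def)
      next
        case 3
        then have "z = a \<or> z = x \<or> a = x"
          using general_position_orient[OF gp ab(1) less.prems(1) z(1)] by auto
        then show False using abz bxz axy by auto
      qed
    qed
    have aqy: "orient a q y > 0" using yaq orient_rotate[of a q y] by simp
    \<comment> \<open>\<open>q\<close> is inside the old triangle but, being a vertex, not inside
      the new one.\<close>
    have smaller: "card (?I u v) < card (?I x y)"
      if "\<And>z. in_triangle a u v z \<Longrightarrow> in_triangle a x y z" "u = q \<or> v = q" for u v
    proof -
      have "?I u v \<subseteq> ?I x y - {q}" using that by (auto simp: in_triangle_def)
      also have "\<dots> \<subset> ?I x y" using q by auto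
      finally show ?thesis using finI by (rule psubset_card_mono[rotated])
    qed
    show ?thesis
    proof (cases "C q = C x")
      case True
      have "in_triangle a x y z" if "in_triangle a q y z" for z
      proof -
        have z: "orient a q z > 0" "orient q y z > 0" "orient y a z > 0"
          using that in_triangle_ccw[OF aqy] by auto
        note pos = orient_pos_in_triangle[OF aqy z]
        show ?thesis unfolding in_triangle_ccw[OF axy]
          using pos[of a x] pos[of x y] z axq axy xyq orient_rotate[of x y a] by simp
      qed
      then have "card (?I q y) < card (?I x y)" by (rule smaller) auto
      then show ?thesis
        using less.prems True qS abq eq aqy by (intro less.hyps[of q y]) auto
    next
      case False
      have "in_triangle a x y z" if "in_triangle a x q z" for z
      proof -
        have z: "orient a x z > 0" "orient x q z > 0" "orient q a z > 0"
          using that in_triangle_ccw[OF axq] by auto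
        note pos = orient_pos_in_triangle[OF axq z]
        show ?thesis unfolding in_triangle_ccw[OF axy]
          using pos[of y a] pos[of x y] z axy yaq xyq orient_rotate[of x y a] orient_rotate'[of y a x]
          by simp
      qed
      then have "card (?I x q) < card (?I x y)" by (rule smaller) auto
      then show ?thesis
        using less.prems False qS abq eq axq by (intro less.hyps[of x q]) auto
    qed
  qed
qed

text \<open>Giving \<open>a\<close>, \<open>b\<close> only as a set lets one statement serve both
  sides of the line \<open>r s\<close>.\<close>

lemma good_if_both_colors_same_side:
  assumes fin: "finite R" "finite B" and gp: "general_position (R \<union> B)" and disj: "R \<inter> B = {}"
    and ab: "{a, b} = {r, s}" and rs: "r \<in> R" "s \<in> B" and "p \<in> R" "c \<in> B"
    and abp: "orient a b p > 0" and abc: "orient a b c > 0"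
    and e: "empty_triangle (R \<union> B) a b p" "empty_triangle (R \<union> B) a b c"
  shows "good R B r s"
proof -
  let ?S = "R \<union> B"
  have abS: "a \<in> ?S" "b \<in> ?S" using ab rs by (auto simp: doubleton_eq_iff)
  have "\<exists>x\<in>?S. \<exists>y\<in>?S. orient a b x > 0 \<and> empty_triangle ?S a b x \<and> orient a b y > 0
     \<and> orient a x y > 0 \<and> (x \<in> R) \<noteq> (y \<in> R) \<and> empty_triangle ?S a x y"
  proof -
    have "a \<noteq> p" "p \<noteq> c" "a \<noteq> c" using abp abc assms by auto
    then have "orient a p c \<noteq> 0" using gp abS assms by (intro general_position_orient[of ?S]) auto
    then consider "orient a p c > 0" | "orient a c p > 0"
      using orient_swap'[of a p c] by linarith
    then show ?thesis
      using color_change_empty[OF _ gp abS, of p c "\<lambda>x. x \<in> R"]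
        color_change_empty[OF _ gp abS, of c p "\<lambda>x. x \<in> R"] assms by cases auto
  qed
  then obtain x y where xy: "x \<in> ?S" "y \<in> ?S" "orient a b x > 0" "empty_triangle ?S a b x"
      "orient a b y > 0" "orient a x y > 0" "(x \<in> R) \<noteq> (y \<in> R)" "empty_triangle ?S a x y"
    by blast
  have d: "x \<noteq> a" "x \<noteq> b" "y \<noteq> a" "y \<noteq> b" using xy by auto
  have o: "orient a x b * orient a x y < 0"
    using xy orient_swap'[of a x b] by (simp add: mult_less_0_iff)
  have e: "empty_triangle ?S a x b"
    using xy(4) by (metis empty_triangle_rotate empty_triangle_swap)
  have rsd: "r \<noteq> x" "r \<noteq> y" "s \<noteq> x" "s \<noteq> y" using d ab by (auto simp: doubleton_eq_iff)
  have v: "{a, b, x, y} = {r, x, s, y}" "{a, b, x, y} = {r, y, s, x}"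
    using ab by (auto simp: doubleton_eq_iff)
  show ?thesis
  proof (cases "x \<in> R")
    case True
    then show ?thesis
      using goodI[OF gp disj rs(1) True rsd(1) rs(2) _ rsd(4) v(1) o e xy(8)] xy by auto
  next
    case False
    then show ?thesis
      using goodI[OF gp disj rs(1) _ rsd(2) rs(2) _ rsd(3) v(2) o e xy(8)] xy by auto
  qed
qed

text \<open>On opposite sides of \<open>r s\<close>, the points \<open>p\<close> and
  \<open>c\<close> give a hole with diagonal \<open>r s\<close>; otherwise a color change on their
  common side gives one. Requiring \<open>p \<noteq> r\<close> and \<open>c \<noteq> s\<close>
  excludes degenerate triangles.\<close>

lemma good_if_both_colors:
  assumes fin: "finite R" "finite B" and gp: "general_position (R \<union> B)" and disj: "R \<inter> B = {}"
    and rs: "r \<in> R" "s \<in> B" and pc: "p \<in> R" "c \<in> B" "p \<noteq> r" "c \<noteq> s"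
    and e: "empty_triangle (R \<union> B) r s p" "empty_triangle (R \<union> B) r s c"
  shows "good R B r s"
proof -
  have d: "r \<noteq> s" "p \<noteq> s" "c \<noteq> r" using rs pc disj by auto
  have "orient r s p \<noteq> 0" "orient r s c \<noteq> 0"
    using general_position_orient[OF gp] rs pc d by auto
  then consider "orient r s p * orient r s c < 0" | "orient r s p > 0" "orient r s c > 0"
    | "orient s r p > 0" "orient s r c > 0"
    using orient_swap[of r s p] orient_swap[of r s c] by (auto simp: mult_less_0_iff neq_iff)
  then show ?thesis
  proof cases
    case 1
    then show ?thesis using goodI[OF gp disj rs(1) pc(1) _ rs(2) pc(2) _ _ 1 e] pc by auto
  next
    case 2
    then show ?thesis using good_if_both_colors_same_side[OF fin gp disj _ rs pc(1,2) 2 e] by auto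
  next
    case 3
    then show ?thesis
      using good_if_both_colors_same_side[OF fin gp disj _ rs pc(1,2) 3] e
      by (auto simp: empty_triangle_swap)
  qed
qed


section \<open>Wedges with few points\<close>

text \<open>The interior of \<open>r p q\<close> lies in the open wedge, so only the points of
  \<open>D\<close> can spoil emptiness. The weak inequalities admit \<open>p = b\<close> and
  \<open>q = b'\<close>.\<close>

lemma empty_triangle_in_wedge:
  assumes wedge: "orient r b b' > 0"
    and p: "orient r b p \<ge> 0" "orient r p b' \<ge> 0" and q: "orient r b q \<ge> 0" "orient r q b' \<ge> 0"
    and rpq: "orient r p q > 0" and S: "{z \<in> S. orient r b z > 0 \<and> orient r z b' > 0} \<subseteq> D"
    and D: "\<And>z. z \<in> D \<Longrightarrow> \<not> in_triangle r p q z"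
  shows "empty_triangle S r p q"
  unfolding empty_triangle_def
proof (intro ballI notI)
  fix z assume z: "z \<in> S" "in_triangle r p q z"
  then have z': "orient r p z > 0" "orient p q z > 0" "orient q r z > 0"
    using in_triangle_ccw[OF rpq] by auto
  note pos = orient_pos_in_triangle[OF rpq z']
  have rot: "orient b' r p = orient r p b'" "orient b' r q = orient r q b'"
    by (simp_all add: orient_rotate')
  \<comment> \<open>\<open>p\<close> and \<open>q\<close> cannot both lie on the line
    \<open>r b\<close>, since \<open>r p q\<close> is nondegenerate. The identity is the three-term
    Grassmann-Pluecker relation for the vectors from \<open>r\<close>.\<close>
  have "orient r b p > 0 \<or> orient r b q > 0"
  proof (rule ccontr)
    assume "\<not> ?thesis"
    then have "orient r b p = 0" "orient r b q = 0" using p q by auto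
    moreover have "orient r b b' * orient r p q = orient r b p * orient r b' q - orient r b q * orient r b' p"
      by (simp add: orient_def algebra_simps)
    ultimately show False using wedge rpq by simp
  qed
  then have 1: "orient r b z > 0" using pos[of r b] p q by simp
  have "orient b' r p > 0 \<or> orient b' r q > 0"
  proof (rule ccontr)
    assume "\<not> ?thesis"
    then have "orient r p b' = 0" "orient r q b' = 0" using p q rot by auto
    moreover have "orient r b b' * orient r p q = orient r q b' * orient r p b - orient r p b' * orient r q b"
      by (simp add: orient_def algebra_simps)
    ultimately show False using wedge rpq by simp
  qed
  then have "orient b' r z > 0" using pos[of b' r] p q rot by simp
  then have "orient r z b' > 0" by (simp add: orient_rotate)
  then show False using 1 z S D by auto
qed

text \<open>Each hole found has the vertices \<open>r\<close>, \<open>b\<close>, \<open>b'\<close>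
  and one red point of \<open>D\<close>. A diagonal from \<open>r\<close> to a point of
  \<open>D\<close> works unless each of two points blocks the other.\<close>

lemma good_if_small_wedge:
  assumes gp: "general_position (R \<union> B)" and disj: "R \<inter> B = {}"
    and r: "r \<in> R" and b: "b \<in> B" "b' \<in> B" and rbb': "orient r b b' > 0"
    and D: "D = {z \<in> R \<union> B. orient r b z > 0 \<and> orient r z b' > 0}" and DR: "D \<subseteq> R"
    and card: "card D = 1 \<or> card D = 2"
  shows "good R B r b"
proof -
  let ?S = "R \<union> B"
  have bb': "b \<noteq> b'" using rbb' by auto
  have in_D: "orient r b z > 0" "orient r z b' > 0" "z \<in> R" "z \<noteq> r" if "z \<in> D" for z
    using that DR unfolding D by auto
  have empty_b: "empty_triangle ?S r b p"
    if p: "p \<in> D" and "\<And>z. z \<in> D \<Longrightarrow> \<not> in_triangle r b p z" for p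
    using in_D[OF p] rbb' that(2) D
    by (intro empty_triangle_in_wedge[of r b b' b p ?S D]) auto
  have empty_b': "empty_triangle ?S r p b'"
    if p: "p \<in> D" and "\<And>z. z \<in> D \<Longrightarrow> \<not> in_triangle r p b' z" for p
    using in_D[OF p] rbb' that(2) D
    by (intro empty_triangle_in_wedge[of r b b' p b' ?S D]) auto
  have good_diagonal: "good R B r b"
    if p: "p \<in> D" and e: "empty_triangle ?S r b p" "empty_triangle ?S r p b'" for p
  proof (rule goodI[OF gp disj r _ _ b(1,2) bb'])
    show "p \<in> R" "r \<noteq> p" using in_D[OF p] by auto
    show "{r, b, p, b'} = {r, p, b, b'}" by auto
    show "orient r p b * orient r p b' < 0"
      using in_D[OF p] orient_swap'[of r p b] by (simp add: mult_less_0_iff)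
    show "empty_triangle ?S r p b" using e(1) by (metis empty_triangle_rotate empty_triangle_swap)
    show "empty_triangle ?S r p b'" by (rule e)
  qed
  from card show ?thesis
  proof
    assume "card D = 1"
    then obtain p where p: "D = {p}" by (auto simp: card_1_singleton_iff)
    have "\<not> in_triangle r b p p" "\<not> in_triangle r p b' p" by (auto simp: in_triangle_def)
    then show ?thesis using p by (intro good_diagonal[of p] empty_b empty_b') auto
  next
    assume "card D = 2"
    then obtain p0 q0 where pq0: "D = {p0, q0}" "p0 \<noteq> q0" by (auto simp: card_2_iff)
    have "orient r p0 q0 \<noteq> 0"
      using in_D[of p0] in_D[of q0] pq0 r general_position_orient[OF gp, of r p0 q0] by auto
    then consider "orient r p0 q0 > 0" | "orient r q0 p0 > 0"
      using orient_swap'[of r p0 q0] by linarith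
    then obtain p q where D_eq: "D = {p, q}" and rpq: "orient r p q > 0"
      using pq0(1) by (metis insert_commute)
    have pD: "p \<in> D" and qD: "q \<in> D" using D_eq by auto
    note p = in_D[OF pD] and q = in_D[OF qD]
    have rbp: "orient r b p > 0" and rqb': "orient r q b' > 0" using p q by auto
    have e1: "empty_triangle ?S r b p"
    proof (rule empty_b[OF pD])
      fix z assume "z \<in> D"
      then show "\<not> in_triangle r b p z"
        unfolding in_triangle_ccw[OF rbp] using D_eq rpq orient_swap[of r p q] by auto
    qed
    have e2: "empty_triangle ?S r q b'"
    proof (rule empty_b'[OF qD])
      fix z assume "z \<in> D"
      then show "\<not> in_triangle r q b' z"
        unfolding in_triangle_ccw[OF rqb'] using D_eq rpq orient_swap'[of r p q] by auto
    qed
    show ?thesis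
    proof (cases "in_triangle r p b' q \<and> in_triangle r b q p")
      case False
      then consider "\<not> in_triangle r p b' q" | "\<not> in_triangle r b q p" by blast
      then show ?thesis
      proof cases
        case 1
        then have "empty_triangle ?S r p b'"
          using D_eq by (intro empty_b'[OF pD]) (auto simp: in_triangle_def)
        then show ?thesis using good_diagonal[OF pD e1] by simp
      next
        case 2
        then have "empty_triangle ?S r b q"
          using D_eq by (intro empty_b[OF qD]) (auto simp: in_triangle_def)
        then show ?thesis using good_diagonal[OF qD _ e2] by simp
      qed
    next
      case True
      \<comment> \<open>\<open>b\<close>, \<open>p\<close>, \<open>q\<close>, \<open>b'\<close> is a chain bending towards \<open>r\<close>, so neither \<open>r b p b'\<close> nor \<open>r b q b'\<close>
        is empty; the hole is \<open>r b b' p\<close>, with diagonal \<open>b p\<close>.\<close>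
      have rpb': "orient r p b' > 0" and rbq: "orient r b q > 0" using p q by auto
      have pb'q: "orient p b' q > 0" and b'rq: "orient b' r q > 0"
        using True in_triangle_ccw[OF rpb'] by auto
      have "orient b q p > 0" using True in_triangle_ccw[OF rbq] by auto
      then have bpq: "orient b p q < 0" using orient_swap'[of b p q] by simp
      have bpr: "orient b p r > 0" using rbp by (simp add: orient_rotate)
      \<comment> \<open>\<open>q\<close> is a positive combination of \<open>r\<close>,
        \<open>p\<close>, \<open>b'\<close>. The line \<open>b p\<close> passes through
        \<open>p\<close> and separates \<open>q\<close> from \<open>r\<close>, so \<open>b'\<close>
        must be on the side of \<open>q\<close>.\<close>
      have bpb': "orient b p b' < 0"
      proof -
        have "orient r p b' * orient b p q < 0" "orient p b' q * orient b p r > 0"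
          using rpb' bpq pb'q bpr by (auto simp: mult_less_0_iff)
        then have "orient r p q * orient b p b' < 0"
          using orient_barycentric[of r p b' b p q] by simp
        then show ?thesis using rpq by (simp add: mult_less_0_iff)
      qed
      have bb'p: "orient b b' p > 0" using bpb' orient_swap'[of b b' p] by simp
      \<comment> \<open>The interior of \<open>b p b'\<close> lies in the wedge, where only
        \<open>p\<close> and \<open>q\<close> are available; \<open>p\<close> is a vertex and
        \<open>q\<close> is across the line \<open>p b'\<close>.\<close>
      have e3: "empty_triangle ?S b p b'"
        unfolding empty_triangle_def
      proof (intro ballI notI)
        fix z assume z: "z \<in> ?S" "in_triangle b p b' z"
        then have "in_triangle b b' p z" by (metis in_triangle_rotate in_triangle_swap)
        then have z': "orient b b' z > 0" "orient b' p z > 0" "orient p b z > 0"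
          using in_triangle_ccw[OF bb'p] by auto
        note pos = orient_pos_in_triangle[OF bb'p z']
        have "orient r b z > 0" using pos[of r b] rbb' rbp by simp
        moreover have "orient b' r z > 0"
          using pos[of b' r] rbb' rpb' orient_rotate'[of b' r b] orient_rotate'[of b' r p] by simp
        then have "orient r z b' > 0" by (simp add: orient_rotate)
        ultimately have "z \<in> {p, q}" using z D D_eq by auto
        then show False using z' pb'q orient_swap[of p b' q] by auto
      qed
      show ?thesis
      proof (rule goodI[OF gp disj r _ _ b(1,2) bb'])
        show "p \<in> R" "r \<noteq> p" using p by auto
        show "{b, r, p, b'} = {r, p, b, b'}" by auto
        show "orient b p r * orient b p b' < 0" using bpr bpb' by (simp add: mult_less_0_iff)
        show "empty_triangle ?S b p r" using e1 by (simp add: empty_triangle_rotate)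
        show "empty_triangle ?S b p b'" by (rule e3)
      qed
    qed
  qed
qed

section \<open>Angular order and secluded partners\<close>

lemma obtain_next_around:
  assumes "finite B" "\<exists>c\<in>B. orient r b c > 0"
  obtains b' where "b' \<in> B" "orient r b b' > 0"
    "\<And>c. c \<in> B \<Longrightarrow> orient r b c > 0 \<Longrightarrow> \<not> orient r c b' > 0"
proof -
  let ?F = "{c \<in> B. orient r b c > 0}"
  define dot where "dot c = (Re b - Re r) * (Re c - Re r) + (Im b - Im r) * (Im c - Im r)" for c
  \<comment> \<open>minus the cotangent of the angle between the rays from \<open>r\<close> through \<open>b\<close> and \<open>c\<close>\<close>
  define key where "key c = - dot c / orient r b c" for c
  have "finite ?F" "?F \<noteq> {}" using assms by auto
  then obtain b' where b': "b' \<in> ?F" and min: "\<And>c. c \<in> ?F \<Longrightarrow> key b' \<le> key c"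
    using ex_is_arg_min_if_finite[of ?F key] by (auto simp: is_arg_min_linorder)
  have False if c: "c \<in> B" "orient r b c > 0" "orient r c b' > 0" for c
  proof -
    have "b \<noteq> r" using c by auto
    then have "(Re b - Re r)\<^sup>2 + (Im b - Im r)\<^sup>2 > 0"
      by (auto simp: complex_eq_iff sum_power2_gt_zero_iff)
    then have "((Re b - Re r)\<^sup>2 + (Im b - Im r)\<^sup>2) * orient r c b' > 0" using c by simp
    \<comment> \<open>The addition formula for the sine of the angle from \<open>c\<close> to
      \<open>b'\<close>, multiplied by the lengths.\<close>
    also have "((Re b - Re r)\<^sup>2 + (Im b - Im r)\<^sup>2) * orient r c b' =
        dot c * orient r b b' - dot b' * orient r b c"
      by (simp add: orient_def dot_def algebra_simps power2_eq_square)
    finally have "dot b' * orient r b c < dot c * orient r b b'" by simp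
    then have "key c < key b'"
      using c b' by (simp add: key_def field_simps)
    then show False using min[of c] c by simp
  qed
  then show thesis using that b' by blast
qed

text \<open>The bad partners of \<open>r\<close> for which no blue third vertex occurs. Exchanging
  \<open>R\<close> and \<open>B\<close> gives the bad pairs without a red one.\<close>

definition secluded :: "complex set \<Rightarrow> complex set \<Rightarrow> complex \<Rightarrow> complex set" where
  "secluded R B r = {b \<in> B. \<not> good R B r b \<and> (\<forall>c\<in>B - {b}. \<not> empty_triangle (R \<union> B) r b c)}"

lemma card_secluded:
  assumes fin: "finite R" "finite B" and gp: "general_position (R \<union> B)" and disj: "R \<inter> B = {}"
    and r: "r \<in> R"
  shows "3 * card (secluded R B r) \<le> card R + 2"
proof -
  let ?S = "R \<union> B" and ?M = "secluded R B r"
  \<comment> \<open>The red points met after \<open>b\<close>, within a half turn counterclockwise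
    about \<open>r\<close>, before any further blue point.\<close>
  define W where "W b = {p \<in> R. orient r b p > 0 \<and> (\<forall>c\<in>B. \<not> (orient r b c > 0 \<and> orient r c p > 0))}" for b
  \<comment> \<open>Those without a blue successor within a half turn; of two distinct blue points
    one lies to the left of the other, so there is at most one.\<close>
  define E where "E = {b \<in> ?M. \<forall>c\<in>B. \<not> orient r b c > 0}"
  have finM: "finite ?M" using fin by (simp add: secluded_def)
  have MB: "?M \<subseteq> B" by (auto simp: secluded_def)
  have cmp: "orient r b c > 0 \<or> orient r c b > 0" if "b \<in> B" "c \<in> B" "b \<noteq> c" for b c
  proof -
    have "orient r b c \<noteq> 0" using general_position_orient[OF gp, of r b c] that r disj by auto
    then show ?thesis using orient_swap'[of r b c] by linarith
  qed
  have "card E \<le> 1"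
  proof -
    have "b = c" if "b \<in> E" "c \<in> E" for b c
      using that cmp[of b c] MB by (auto simp: E_def)
    then show ?thesis using card_le_Suc0_iff_eq[of E] finM by (auto simp: E_def)
  qed
  moreover have "3 * card (?M - E) \<le> card R - 1"
  proof -
    have large: "3 \<le> card (W b)" if b: "b \<in> ?M - E" for b
    proof (rule ccontr)
      assume "\<not> 3 \<le> card (W b)"
      have bB: "b \<in> B" using b MB by auto
      have "\<exists>c\<in>B. orient r b c > 0" using b by (auto simp: E_def)
      from obtain_next_around[OF fin(2) this] obtain b' where b': "b' \<in> B" "orient r b b' > 0"
        and first: "\<And>c. c \<in> B \<Longrightarrow> orient r b c > 0 \<Longrightarrow> \<not> orient r c b' > 0" by blast
      define D where "D = {z \<in> ?S. orient r b z > 0 \<and> orient r z b' > 0}"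
      have DR: "D \<subseteq> R" using first by (auto simp: D_def)
      have "D \<subseteq> W b"
      proof
        fix p assume p: "p \<in> D"
        \<comment> \<open>A blue point between \<open>b\<close> and \<open>p\<close> would also lie
          between \<open>b\<close> and \<open>b'\<close>, again by the Grassmann-Pluecker
          relation.\<close>
        have False if c: "c \<in> B" "orient r b c > 0" "orient r c p > 0" for c
        proof -
          have "orient r b p * orient r c b' = orient r b c * orient r p b' + orient r b b' * orient r c p"
            by (simp add: orient_def algebra_simps)
          also have "\<dots> > 0" using c p b' by (auto simp: D_def intro!: add_pos_pos)
          finally have "orient r c b' > 0" using p by (simp add: D_def zero_less_mult_iff)
          then show False using first c by blast
        qed
        then show "p \<in> W b" using p DR by (auto simp: W_def D_def)
      qed
      then have "card D \<le> card (W b)" using fin by (intro card_mono) (auto simp: W_def)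
      then have "card D \<in> {0, 1, 2}" using \<open>\<not> 3 \<le> card (W b)\<close> by auto
      moreover have "card D \<noteq> 1" "card D \<noteq> 2"
        using good_if_small_wedge[OF gp disj r bB b' D_def DR] b by (auto simp: secluded_def)
      ultimately have "D = {}" using fin by (simp add: D_def)
      then have "empty_triangle ?S r b b'"
        using b' by (intro empty_triangle_in_wedge[of r b b' b b' ?S "{}"]) (auto simp: D_def)
      moreover have "b' \<in> B - {b}" using b' by auto
      ultimately show False using b by (auto simp: secluded_def)
    qed
    have "disjoint_family_on W (?M - E)"
    proof (unfold disjoint_family_on_def, intro ballI impI)
      fix b c assume bc: "b \<in> ?M - E" "c \<in> ?M - E" "b \<noteq> c"
      then have "b \<in> B" "c \<in> B" using MB by auto
      \<comment> \<open>If \<open>c\<close> is to the left of \<open>r b\<close>, every point of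
        \<open>W c\<close> has the blue point \<open>c\<close> before it and so is not in
        \<open>W b\<close>.\<close>
      then show "W b \<inter> W c = {}" using cmp[of b c] bc by (auto simp: W_def)
    qed
    moreover have finW: "finite (W b)" for b using fin by (simp add: W_def)
    ultimately have "card (\<Union>b\<in>?M - E. W b) = (\<Sum>b\<in>?M - E. card (W b))"
      using finM by (intro card_UN_disjoint') auto
    moreover have "(\<Sum>b\<in>?M - E. 3) \<le> (\<Sum>b\<in>?M - E. card (W b))"
      by (intro sum_mono large)
    moreover have "card (\<Union>b\<in>?M - E. W b) \<le> card (R - {r})"
      using fin by (intro card_mono) (auto simp: W_def)
    ultimately show ?thesis using r fin by simp
  qed
  moreover have "card ?M = card E + card (?M - E)"
    using finM by (subst card_Un_disjoint[symmetric]) (auto simp: E_def intro!: arg_cong[of _ _ card])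
  \<comment> \<open>Makes \<open>card R - 1\<close>, which discounts \<open>r\<close> itself, a true
    difference: \<open>3 * 1 + (card R - 1) = card R + 2\<close>.\<close>
  moreover have "card R \<ge> 1" using r fin by (simp add: Suc_le_eq card_gt_0_iff) auto
  ultimately show ?thesis by linarith
qed

section \<open>Counting pairs against holes\<close>

lemma finite_balanced_4holes:
  assumes "finite R" "finite B"
  shows "finite (balanced_4holes R B)"
proof -
  have "balanced_4holes R B \<subseteq> Pow (Pow (R \<union> B))"
    by (auto simp: balanced_4holes_def is_4hole_def quad_edges_def)
  then show ?thesis using assms by (auto intro: finite_subset)
qed

text \<open>Each balanced hole covers exactly \<open>2 * 2\<close> red-blue pairs; a pair may be
  covered repeatedly, hence only an inequality.\<close>

lemma card_good_pairs:
  assumes fin: "finite R" "finite B"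
  shows "card {(r, b) \<in> R \<times> B. good R B r b} \<le> 4 * card (balanced_4holes R B)"
proof -
  let ?P = "\<lambda>Q. (\<Union>Q \<inter> R) \<times> (\<Union>Q \<inter> B)"
  have "{(r, b) \<in> R \<times> B. good R B r b} \<subseteq> (\<Union>Q\<in>balanced_4holes R B. ?P Q)"
    by (auto simp: good_def)
  then have "card {(r, b) \<in> R \<times> B. good R B r b} \<le> card (\<Union>Q\<in>balanced_4holes R B. ?P Q)"
    using fin finite_balanced_4holes by (intro card_mono) auto
  also have "\<dots> \<le> (\<Sum>Q\<in>balanced_4holes R B. card (?P Q))"
    using finite_balanced_4holes[OF fin] by (rule card_UN_le)
  also have "\<dots> = (\<Sum>Q\<in>balanced_4holes R B. 4)"
  proof (rule sum.cong)
    fix Q assume "Q \<in> balanced_4holes R B"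
    then have "card (\<Union>Q \<inter> R) = 2" "card (\<Union>Q \<inter> B) = 2"
      by (auto simp: balanced_4holes_def Union_quad_edges simp del: Int_insert_left)
    then show "card (?P Q) = 4" by (simp add: card_cartesian_product)
  qed simp
  finally show ?thesis by simp
qed

theorem theorem1:
  fixes R B :: "complex set" and n :: nat
  assumes "finite R" "finite B" "R \<inter> B = {}"
    and "card R = n" "card B = n"
    and "general_position (R \<union> B)"
  shows "real (card (balanced_4holes R B)) \<ge> (real n ^ 2 - 4 * real n) / 12"
proof -
  note fin = assms(1,2) and disj = assms(3) and gp = assms(6)
  have gp': "general_position (B \<union> R)" and disj': "B \<inter> R = {}"
    using gp disj by (simp_all add: Un_commute Int_commute)
  let ?G = "{(r, b) \<in> R \<times> B. good R B r b}"
  let ?M = "Sigma R (secluded R B)" and ?N = "(\<lambda>(b, r). (r, b)) ` Sigma B (secluded B R)"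
  \<comment> \<open>A bad pair outside \<open>?M\<close> and \<open>?N\<close> would have empty
    triangles with third vertices of both colors.\<close>
  have "R \<times> B \<subseteq> ?G \<union> ?M \<union> ?N"
  proof safe
    fix r b assume rb: "r \<in> R" "b \<in> B" and notN: "(r, b) \<notin> ?N" and notM: "b \<notin> secluded R B r"
    have "r \<notin> secluded B R b" using notN rb by force
    show "good R B r b"
    proof (rule ccontr)
      assume bad: "\<not> good R B r b"
      obtain c where "c \<in> B - {b}" "empty_triangle (R \<union> B) r b c"
        using notM bad rb by (auto simp: secluded_def)
      moreover obtain p where "p \<in> R - {r}" "empty_triangle (R \<union> B) r b p"
        using \<open>r \<notin> secluded B R b\<close> bad rb
        by (auto simp: secluded_def good_commute[of B R] Un_commute[of B R] empty_triangle_swap[of _ b r])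
      ultimately show False using good_if_both_colors[OF fin gp disj rb] bad by blast
    qed
  qed
  moreover have finS: "finite (secluded R B r)" "finite (secluded B R b)" for r b
    using fin by (auto simp: secluded_def)
  have "finite ?G" using fin by (auto intro: finite_subset[of _ "R \<times> B"])
  ultimately have "card (R \<times> B) \<le> card (?G \<union> ?M \<union> ?N)"
    using fin finS by (intro card_mono) auto
  also have "\<dots> \<le> card ?G + card ?M + card ?N"
    using card_Un_le[of "?G \<union> ?M" ?N] card_Un_le[of ?G ?M] by linarith
  finally have "n * n \<le> card ?G + card ?M + card ?N"
    using assms(4,5) by (simp add: card_cartesian_product)
  moreover have "3 * card ?M \<le> n * (n + 2)"
  proof -
    have "3 * card ?M = (\<Sum>r\<in>R. 3 * card (secluded R B r))"
      using fin finS by (simp add: sum_distrib_left)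
    also have "\<dots> \<le> (\<Sum>r\<in>R. n + 2)"
      using card_secluded[OF fin gp disj] assms(4) by (intro sum_mono) auto
    finally show ?thesis using assms(4) by simp
  qed
  moreover have "3 * card ?N \<le> n * (n + 2)"
  proof -
    have "3 * card ?N \<le> 3 * card (Sigma B (secluded B R))"
      using fin finS by (intro mult_le_mono2 card_image_le) auto
    also have "\<dots> = (\<Sum>b\<in>B. 3 * card (secluded B R b))"
      using fin finS by (simp add: sum_distrib_left)
    also have "\<dots> \<le> (\<Sum>b\<in>B. n + 2)"
      using card_secluded[OF fin(2,1) gp' disj'] assms(5) by (intro sum_mono) auto
    finally show ?thesis using assms(5) by simp
  qed
  moreover have "card ?G \<le> 4 * card (balanced_4holes R B)" by (rule card_good_pairs[OF fin])
  \<comment> \<open>Kept free of subtraction, which would truncate in the naturals; the real form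
    follows from \<open>3*n*n - 2*n*(n+2) = n*n - 4*n\<close>.\<close>
  ultimately have "3 * (n * n) \<le> 12 * card (balanced_4holes R B) + 2 * (n * (n + 2))"
    by linarith
  then have "real (3 * (n * n)) \<le> real (12 * card (balanced_4holes R B) + 2 * (n * (n + 2)))"
    by (rule of_nat_mono)
  then show ?thesis by (simp add: field_simps power2_eq_square)
qed

end
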